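(* Let $K$ be a finite set with $n=|K|\ge2$ and $\phi,\tau\in L[K]$. Then, as polynomials in an indeterminate $t$, $$(t-1)^{\mathrm{mt}_\tau(\phi)}\,t^{\mathrm{rst}_\tau(\phi)}\,(t+1)^{\mathrm{io}_\tau(\phi)}=\sum_{\gamma\in\Phi_\tau(\phi)}(-1)^{n-\ell(\gamma)}\prod_{\substack{1\le i\le\ell(\gamma)\\ 1_\tau,m_\tau\notin\gamma(r_i)}}(\gamma_it+1).$$
   Context: $L[K]$ is the set of linear orders on $K$; an order is identified with the word listing $K$ in increasing order. For $\tau\in L[K]$, $1_\tau$ and $m_\tau$ are the $\tau$-smallest and $\tau$-largest elements of $K$. A skew ribbon shape $\Gamma$ of size $n$ is a sequence of $n$ cells $c_1,\dots,c_n$ in the plane (up to translation) such that each $c_{j+1}$ is immediately east, immediately south, or immediately (diagonally) southeast of $c_j$. Rows $r_1,r_2,\dots$ are numbered from top to bottom; $\ell(\gamma)$ is the number of rows and $\gamma_i$ the number of cells of row $i$. A standard filling (w.r.t. $\tau$) is a bijection $\gamma:\Gamma\to K$ whose values increase with respect to $\tau$ along each row from left to right and along each column from bottom to top; $\gamma(r_i)$ is the set of values in row $i$. $\phi\in L[K]$ fits $\Gamma$ w.r.t. $\tau$ if the filling $\gamma_\phi$ putting the $j$-th letter of $\phi$ in cell $c_j$ is standard w.r.t. $\tau$, and whenever $c_{j+1}$ is strictly southeast of $c_j$ the $j$-th letter of $\phi$ is $\tau$-smaller than the $(j+1)$-st. $\Phi_\tau(\phi)$ is the set of fillings $\gamma_\phi$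 over all skew ribbon shapes $\Gamma$ that $\phi$ fits w.r.t. $\tau$ such that every row contains at most one of $1_\tau,m_\tau$. Let $\phi=\phi_1\cdots\phi_k$ be the factorization of $\phi$ into maximal rising subsequences w.r.t. $\tau$ (cut the word where the next letter is $\tau$-smaller), $\ell_i$ the length of $\phi_i$. Then $\mathrm{mt}_\tau(\phi)=\sum_{i:\ell_i>1}(\ell_i-2)$, $\mathrm{io}_\tau(\phi)=\#\{i:\ell_i=1,\ 1_\tau,m_\tau\notin\phi_i\}$, $\mathrm{rst}_\tau(\phi)=n-2-\mathrm{mt}_\tau(\phi)-\mathrm{io}_\tau(\phi)$. *)

theory Defs
  imports "HOL-Combinatorics.Multiset_Permutations" "HOL-Computational_Algebra.Polynomial"
begin

text \<open>
  A linear order on a finite set \<open>K\<close> is represented by the word listing \<open>K\<close> increasingly, so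
  that \<open>L[K]\<close> is \<^term>\<open>permutations_of_set K\<close>, the set of all distinct lists with set \<open>K\<close>.
\<close>

definition prec :: "'a list \<Rightarrow> 'a \<Rightarrow> 'a \<Rightarrow> bool" where
  "prec \<tau> x y \<longleftrightarrow> (\<exists>i j. i < j \<and> j < length \<tau> \<and> \<tau> ! i = x \<and> \<tau> ! j = y)"

definition smallest :: "'a list \<Rightarrow> 'a" where
  "smallest \<tau> = hd \<tau>"

definition largest :: "'a list \<Rightarrow> 'a" where
  "largest \<tau> = last \<tau>"


text \<open>
  Cells are pairs (row, column) in matrix coordinates, rows being numbered from top to bottom.
  Shapes are taken up to translation; the representative chosen is the one whose first cell is
  \<open>(1, 1)\<close>, so that the rows of a shape with \<open>\<ell>\<close> rows are exactly the rows \<open>1, \<dots>, \<ell>\<close>.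
\<close>

type_synonym cell = "nat \<times> nat"

definition east_of :: "cell \<Rightarrow> cell \<Rightarrow> bool" where
  "east_of c d \<longleftrightarrow> fst d = fst c \<and> snd d = snd c + 1"

definition south_of :: "cell \<Rightarrow> cell \<Rightarrow> bool" where
  "south_of c d \<longleftrightarrow> fst d = fst c + 1 \<and> snd d = snd c"

definition southeast_of :: "cell \<Rightarrow> cell \<Rightarrow> bool" where
  "southeast_of c d \<longleftrightarrow> fst d = fst c + 1 \<and> snd d = snd c + 1"

definition skew_ribbon :: "cell list \<Rightarrow> bool" where
  "skew_ribbon \<Gamma> \<longleftrightarrow> \<Gamma> \<noteq> [] \<and> hd \<Gamma> = (1, 1) \<and>
     (\<forall>j. Suc j < length \<Gamma> \<longrightarrow>
        east_of (\<Gamma> ! j) (\<Gamma> ! Suc j) \<or> south_of (\<Gamma> ! j) (\<Gamma> ! Suc j) \<or>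
        southeast_of (\<Gamma> ! j) (\<Gamma> ! Suc j))"

text \<open>
  A filling is a partial map on cells whose domain is the underlying shape; in particular,
  fillings of different shapes are different.
\<close>

type_synonym 'a filling = "cell \<rightharpoonup> 'a"

definition standard_filling :: "'a list \<Rightarrow> cell list \<Rightarrow> 'a filling \<Rightarrow> bool" where
  "standard_filling \<tau> \<Gamma> \<gamma> \<longleftrightarrow>
     dom \<gamma> = set \<Gamma> \<and> bij_betw (\<lambda>c. the (\<gamma> c)) (set \<Gamma>) (set \<tau>) \<and>
     (\<forall>i j j' x y. j < j' \<and> \<gamma> (i, j) = Some x \<and> \<gamma> (i, j') = Some y \<longrightarrow> prec \<tau> x y) \<and>
     (\<forall>i i' j x y. i < i' \<and> \<gamma> (i, j) = Some x \<and> \<gamma> (i', j) = Some y \<longrightarrow> prec \<tau> y x)"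

definition num_rows :: "'a filling \<Rightarrow> nat" where
  "num_rows \<gamma> = card (fst ` dom \<gamma>)"

definition row_size :: "'a filling \<Rightarrow> nat \<Rightarrow> nat" where
  "row_size \<gamma> i = card {c \<in> dom \<gamma>. fst c = i}"

definition row_values :: "'a filling \<Rightarrow> nat \<Rightarrow> 'a set" where
  "row_values \<gamma> i = {x. \<exists>j. \<gamma> (i, j) = Some x}"

definition word_filling :: "'a list \<Rightarrow> cell list \<Rightarrow> 'a filling" where
  "word_filling \<phi> \<Gamma> = map_of (zip \<Gamma> \<phi>)"

definition fits :: "'a list \<Rightarrow> 'a list \<Rightarrow> cell list \<Rightarrow> bool" where
  "fits \<tau> \<phi> \<Gamma> \<longleftrightarrow>
     length \<Gamma> = length \<phi> \<and> standard_filling \<tau> \<Gamma> (word_filling \<phi> \<Gamma>) \<and>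
     (\<forall>j. Suc j < length \<Gamma> \<and> southeast_of (\<Gamma> ! j) (\<Gamma> ! Suc j) \<longrightarrow> prec \<tau> (\<phi> ! j) (\<phi> ! Suc j))"

definition Phi :: "'a list \<Rightarrow> 'a list \<Rightarrow> 'a filling set" where
  "Phi \<tau> \<phi> = {word_filling \<phi> \<Gamma> | \<Gamma>. skew_ribbon \<Gamma> \<and> fits \<tau> \<phi> \<Gamma> \<and>
     (\<forall>i. \<not> (smallest \<tau> \<in> row_values (word_filling \<phi> \<Gamma>) i \<and>
             largest \<tau> \<in> row_values (word_filling \<phi> \<Gamma>) i))}"


fun rising_runs :: "'a list \<Rightarrow> 'a list \<Rightarrow> 'a list list" where
  "rising_runs \<tau> [] = []"
| "rising_runs \<tau> [x] = [[x]]"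
| "rising_runs \<tau> (x # y # ws) =
     (let rs = rising_runs \<tau> (y # ws)
      in if prec \<tau> y x then [x] # rs else (x # hd rs) # tl rs)"

definition mt :: "'a list \<Rightarrow> 'a list \<Rightarrow> nat" where
  "mt \<tau> \<phi> = (\<Sum>r \<leftarrow> filter (\<lambda>r. length r > 1) (rising_runs \<tau> \<phi>). length r - 2)"

definition io :: "'a list \<Rightarrow> 'a list \<Rightarrow> nat" where
  "io \<tau> \<phi> = length (filter (\<lambda>r. length r = 1 \<and> smallest \<tau> \<notin> set r \<and> largest \<tau> \<notin> set r)
                     (rising_runs \<tau> \<phi>))"

text \<open>
  The subtraction is never truncated when \<open>n \<ge> 2\<close>; see \<open>mt_io_le\<close> below.
\<close>

definition rst :: "'a list \<Rightarrow> 'a list \<Rightarrow> nat" where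
  "rst \<tau> \<phi> = length \<phi> - 2 - mt \<tau> \<phi> - io \<tau> \<phi>"

lemma rising_runs_neq_Nil: "ws \<noteq> [] \<Longrightarrow> rising_runs \<tau> ws \<noteq> []"
  by (induction \<tau> ws rule: rising_runs.induct) (auto simp: Let_def)

lemma concat_rising_runs: "concat (rising_runs \<tau> ws) = ws"
proof (induction \<tau> ws rule: rising_runs.induct)
  case (3 \<tau> x y ws)
  have "concat (hd rs # tl rs) = concat rs" if "rs \<noteq> []" for rs :: "'a list list"
    using that by simp
  from this[OF rising_runs_neq_Nil[of "y # ws" \<tau>]] 3 show ?case
    by (simp add: Let_def)
qed simp_all

lemma mt_io_le_aux:
  fixes rs :: "'a list list"
  assumes "[] \<notin> set rs"
  shows "(\<Sum>r \<leftarrow> filter (\<lambda>r. length r > 1) rs. length r - 2) +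
         length (filter (\<lambda>r. length r = 1 \<and> a \<notin> set r \<and> b \<notin> set r) rs) +
         card ({a, b} \<inter> set (concat rs)) \<le> length (concat rs)"
  using assms
proof (induction rs)
  case (Cons r rs)
  have split: "card ({a, b} \<inter> set (concat (r # rs))) \<le>
      card ({a, b} \<inter> set r) + card ({a, b} \<inter> set (concat rs))"
    by (simp add: Int_Un_distrib card_Un_le)
  have c2: "card ({a, b} \<inter> set r) \<le> 2"
    using card_mono[of "{a, b}" "{a, b} \<inter> set r"] card_insert_le_m1[of 2 "{b}" a]
    by (auto intro: order_trans)
  have cl: "card ({a, b} \<inter> set r) \<le> length r"
    by (meson Int_lower2 List.finite_set card_length card_mono order_trans)
  have c0: "card ({a, b} \<inter> set r) = 0" if "a \<notin> set r" "b \<notin> set r"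
    using that by simp
  from Cons.prems have "length r > 0" by auto
  from Cons have IH: "(\<Sum>r \<leftarrow> filter (\<lambda>r. length r > 1) rs. length r - 2) +
         length (filter (\<lambda>r. length r = 1 \<and> a \<notin> set r \<and> b \<notin> set r) rs) +
         card ({a, b} \<inter> set (concat rs)) \<le> length (concat rs)"
    by simp
  have head: "(if length r > 1 then length r - 2 else 0) +
      (if length r = 1 \<and> a \<notin> set r \<and> b \<notin> set r then 1 else 0) +
      card ({a, b} \<inter> set r) \<le> length r"
  proof (cases "length r = 1")
    case True
    then show ?thesis
      using cl c0 by (cases "a \<notin> set r \<and> b \<notin> set r") simp_all
  next
    case False
    with \<open>length r > 0\<close> have l: "length r > 1" by linarith
    then have "length r - 2 + card ({a, b} \<inter> set r) \<le> length r"
      using c2 by linarith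
    then show ?thesis
      by (simp only: False l simp_thms if_True if_False add_0_right)
  qed
  have arith: "(m + m') + (p + p') + c \<le> l + l'"
    if "m + p + d \<le> l" "m' + p' + d' \<le> l'" "c \<le> d + d'" for m m' p p' c d d' l l' :: nat
    using that by linarith
  have eqs: "(\<Sum>r \<leftarrow> filter (\<lambda>r. length r > 1) (r # rs). length r - 2) =
      (if length r > 1 then length r - 2 else 0) +
      (\<Sum>r \<leftarrow> filter (\<lambda>r. length r > 1) rs. length r - 2)"
    "length (filter (\<lambda>r. length r = 1 \<and> a \<notin> set r \<and> b \<notin> set r) (r # rs)) =
      (if length r = 1 \<and> a \<notin> set r \<and> b \<notin> set r then 1 else 0) +
      length (filter (\<lambda>r. length r = 1 \<and> a \<notin> set r \<and> b \<notin> set r) rs)"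
    "length (concat (r # rs)) = length r + length (concat rs)"
    by simp_all
  show ?case
    unfolding eqs by (rule arith[OF head IH split])
qed simp

lemma Nil_notin_rising_runs: "[] \<notin> set (rising_runs \<tau> ws)"
proof (induction \<tau> ws rule: rising_runs.induct)
  case (3 \<tau> x y ws)
  then show ?case
    using rising_runs_neq_Nil[of "y # ws" \<tau>] by (auto simp: Let_def dest: list.set_sel(2))
qed simp_all

lemma mt_io_le:
  assumes "card K \<ge> 2" "\<phi> \<in> permutations_of_set K" "\<tau> \<in> permutations_of_set K"
  shows "mt \<tau> \<phi> + io \<tau> \<phi> + 2 \<le> length \<phi>"
proof -
  have s: "set \<phi> = K" "distinct \<phi>" "set \<tau> = K" "distinct \<tau>"
    using assms by (auto simp: permutations_of_set_def)
  have len: "length \<tau> \<ge> 2"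
    using s assms(1) distinct_card by metis
  then have "\<tau> \<noteq> []" by auto
  moreover have "hd \<tau> \<noteq> last \<tau>"
    using len s(4) \<open>\<tau> \<noteq> []\<close> by (auto simp: hd_conv_nth last_conv_nth nth_eq_iff_index_eq)
  moreover have "{hd \<tau>, last \<tau>} \<inter> set \<phi> = {hd \<tau>, last \<tau>}"
    using hd_in_set[OF \<open>\<tau> \<noteq> []\<close>] last_in_set[OF \<open>\<tau> \<noteq> []\<close>] s(1,3) by blast
  ultimately have "card ({smallest \<tau>, largest \<tau>} \<inter> set \<phi>) = 2"
    by (simp add: smallest_def largest_def)
  with mt_io_le_aux[of "rising_runs \<tau> \<phi>" "smallest \<tau>" "largest \<tau>"] s show ?thesis
    by (simp add: concat_rising_runs mt_def io_def Nil_notin_rising_runs)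
qed

end

theory Submission
  imports Defs
begin

text \<open>
  A descent of \<open>\<phi>\<close> forces a step south, an ascent leaves the choice between east and southeast.
  Hence the signed sum obeys a recursion in the first letter \<open>x\<close> of the word, provided it is
  computed together with a variant in which the first row carries only its sign, or 0 if it
  contains an extreme letter. Rows containing both extreme letters get weight 0, so that all
  shapes fitted by \<open>\<phi>\<close> may be summed. If \<open>S\<close> and \<open>T\<close>
  are the two sums for a word that starts above \<open>x\<close>, prepending an ordinary letter \<open>x\<close> turns
  \<open>(S, T)\<close> into \<open>(t (S - T), S - T)\<close>, and prepending the smallest letter turns it into
  \<open>(S - T, 0)\<close>. So \<open>S - T\<close> is multiplied by \<open>t - 1\<close> along a rising run, and a descent
  splits off a factor.
\<close>

section \<open>Enumeration of the fitted ribbons letter by letter\<close>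

text \<open>The start cell is carried along because peeling off the first letter leaves a ribbon
  that starts elsewhere than at \<open>(1, 1)\<close>. The empty word gets no shape, since a ribbon
  has at least one cell.\<close>

fun shapes :: "'a list \<Rightarrow> cell \<Rightarrow> 'a list \<Rightarrow> cell list set" where
  "shapes \<tau> c [] = {}"
| "shapes \<tau> c [x] = {[c]}"
| "shapes \<tau> c (x # y # ws) = (#) c `
     (if prec \<tau> y x then shapes \<tau> (fst c + 1, snd c) (y # ws)
      else shapes \<tau> (fst c, snd c + 1) (y # ws) \<union> shapes \<tau> (fst c + 1, snd c + 1) (y # ws))"

lemma finite_shapes: "finite (shapes \<tau> c ws)"
  by (induction \<tau> c ws rule: shapes.induct) simp_all

lemma shapes_hd: "\<Gamma> \<in> shapes \<tau> c ws \<Longrightarrow> \<Gamma> \<noteq> [] \<and> hd \<Gamma> = c"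
  by (induction \<tau> c ws arbitrary: \<Gamma> rule: shapes.induct) auto

lemma shapes_length: "\<Gamma> \<in> shapes \<tau> c ws \<Longrightarrow> length \<Gamma> = length ws"
  by (induction \<tau> c ws arbitrary: \<Gamma> rule: shapes.induct) (auto split: if_splits)

text \<open>Every step goes weakly south and weakly east. This is what later shows that a prepended
  cell, or a prepended row, is new.\<close>

lemma shapes_ge: "\<Gamma> \<in> shapes \<tau> c ws \<Longrightarrow> d \<in> set \<Gamma> \<Longrightarrow> fst c \<le> fst d \<and> snd c \<le> snd d"
  by (induction \<tau> c ws arbitrary: \<Gamma> rule: shapes.induct)
     (fastforce split: if_splits)+

lemma shapes_distinct: "\<Gamma> \<in> shapes \<tau> c ws \<Longrightarrow> distinct \<Gamma>"
  by (induction \<tau> c ws arbitrary: \<Gamma> rule: shapes.induct)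
     (force split: if_splits dest: shapes_ge)+

text \<open>A step descends by at most one row, so no row is skipped. Hence for the start cell
  \<open>(1, 1)\<close> the occupied rows are exactly those over which the product in the theorem
  runs.\<close>

lemma shapes_rows: "\<Gamma> \<in> shapes \<tau> c ws \<Longrightarrow> \<exists>k\<ge>fst c. fst ` set \<Gamma> = {fst c..k}"
proof (induction \<tau> c ws arbitrary: \<Gamma> rule: shapes.induct)
  case (3 \<tau> c x y ws)
  then obtain d \<Gamma>' where d: "\<Gamma> = c # \<Gamma>'" "\<Gamma>' \<in> shapes \<tau> d (y # ws)"
    "fst d = fst c \<or> fst d = fst c + 1" "\<exists>k\<ge>fst d. fst ` set \<Gamma>' = {fst d..k}"
    by (fastforce split: if_splits)
  then obtain k where "k \<ge> fst d" "fst ` set \<Gamma>' = {fst d..k}" by blast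
  with d show ?case
    by (intro exI[of _ k]) auto
qed auto

text \<open>This replaces the recursion by a condition on consecutive cells, the form in which
  \<open>skew_ribbon\<close> and \<open>fits\<close> are stated.\<close>

lemma shapes_iff:
  "\<Gamma> \<in> shapes \<tau> c ws \<longleftrightarrow> \<Gamma> \<noteq> [] \<and> hd \<Gamma> = c \<and> length \<Gamma> = length ws \<and>
     (\<forall>j. Suc j < length \<Gamma> \<longrightarrow>
        (if prec \<tau> (ws ! Suc j) (ws ! j) then south_of (\<Gamma> ! j) (\<Gamma> ! Suc j)
         else east_of (\<Gamma> ! j) (\<Gamma> ! Suc j) \<or> southeast_of (\<Gamma> ! j) (\<Gamma> ! Suc j)))"
proof (induction \<tau> c ws arbitrary: \<Gamma> rule: shapes.induct)
  case (1 \<tau> c)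
  then show ?case by auto
next
  case (2 \<tau> c x)
  then show ?case by (cases \<Gamma>) auto
next
  case (3 \<tau> c x y ws)
  show ?case
  proof (cases "\<exists>d \<Gamma>'. \<Gamma> = c # d # \<Gamma>'")
    case True
    then obtain d \<Gamma>' where \<Gamma>: "\<Gamma> = c # d # \<Gamma>'" by blast
    \<comment> \<open>Goal and induction hypotheses are folded into this one-step relation, so that
      they can be matched as they stand.\<close>
    define st where "st u v p q \<longleftrightarrow> (if prec \<tau> v u then south_of p q
        else east_of p q \<or> southeast_of p q)" for u v p q
    have all: "(\<forall>j. Suc j < length \<Gamma> \<longrightarrow> Q j) \<longleftrightarrow>
        Q 0 \<and> (\<forall>j. Suc j < length (d # \<Gamma>') \<longrightarrow> Q (Suc j))" for Q
      unfolding \<Gamma> by (metis Suc_less_eq length_Cons not0_implies_Suc zero_less_Suc)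
    \<comment> \<open>The head of a shape is its start cell, so of the possible targets of the first
      step only \<open>d\<close> can contribute.\<close>
    have mem: "\<Gamma> \<in> shapes \<tau> c (x # y # ws) \<longleftrightarrow> st x y c d \<and> d # \<Gamma>' \<in> shapes \<tau> d (y # ws)"
    proof -
      have "e = d" if "d # \<Gamma>' \<in> shapes \<tau> e (y # ws)" for e
        using shapes_hd[OF that] by simp
      then show ?thesis
        by (auto simp: \<Gamma> st_def south_of_def east_of_def southeast_of_def image_iff prod_eq_iff)
           (metis prod.collapse)+
    qed
    have IH: "d # \<Gamma>' \<in> shapes \<tau> d (y # ws) \<longleftrightarrow> length (d # \<Gamma>') = length (y # ws) \<and>
        (\<forall>j. Suc j < length (d # \<Gamma>') \<longrightarrow>
           st ((y # ws) ! j) ((y # ws) ! Suc j) ((d # \<Gamma>') ! j) ((d # \<Gamma>') ! Suc j))"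
      if st: "st x y c d"
    proof -
      \<comment> \<open>The recursion provides one induction hypothesis for each explicit target
        cell; \<open>d\<close> has to be identified with one of them.\<close>
      consider (south) "(fst c + 1, snd c) = d" "prec \<tau> y x" | (east) "(fst c, snd c + 1) = d" "\<not> prec \<tau> y x"
        | (southeast) "(fst c + 1, snd c + 1) = d" "\<not> prec \<tau> y x"
        using st by (cases "prec \<tau> y x")
          (auto simp: st_def south_of_def east_of_def southeast_of_def prod_eq_iff)
      then show ?thesis
      proof cases
        case south
        show ?thesis
          using "3.IH"(1)[OF south(2), of "d # \<Gamma>'"]
          unfolding st_def[symmetric] list.sel south(1) by blast
      next
        case east
        show ?thesis
          using "3.IH"(2)[OF east(2), of "d # \<Gamma>'"]
          unfolding st_def[symmetric] list.sel east(1) by blast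
      next
        case southeast
        show ?thesis
          using "3.IH"(3)[OF southeast(2), of "d # \<Gamma>'"]
          unfolding st_def[symmetric] list.sel southeast(1) by blast
      qed
    qed
    show ?thesis
      unfolding mem st_def[symmetric] all
      by (cases "st x y c d") (simp_all add: \<Gamma> IH del: shapes.simps)
  next
    case False
    have "\<Gamma> \<notin> shapes \<tau> c (x # y # ws)"
    proof
      assume "\<Gamma> \<in> shapes \<tau> c (x # y # ws)"
      with shapes_hd[OF this] shapes_length[OF this] False show False
        by (cases \<Gamma>; cases "tl \<Gamma>") auto
    qed
    moreover have "\<not> (\<Gamma> \<noteq> [] \<and> hd \<Gamma> = c \<and> length \<Gamma> = length (x # y # ws))"
      using False by (cases \<Gamma>; cases "tl \<Gamma>") auto
    ultimately show ?thesis by blast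
  qed
qed

section \<open>Weights of a single row\<close>

text \<open>The exponent \<open>card A - 1\<close> distributes the global sign over the rows: the
  row sizes minus one add up to \<open>n\<close> minus the number of rows.\<close>

definition row_sign :: "'a \<Rightarrow> 'a \<Rightarrow> 'a set \<Rightarrow> 'b::comm_ring_1" where
  "row_sign a b A = (if a \<in> A \<or> b \<in> A then 0 else (-1) ^ (card A - 1))"

definition row_weight :: "'b::comm_ring_1 \<Rightarrow> 'a \<Rightarrow> 'a \<Rightarrow> 'a set \<Rightarrow> 'b" where
  "row_weight t a b A = (if a \<in> A \<and> b \<in> A then 0
     else (-1) ^ (card A - 1) * (if a \<in> A \<or> b \<in> A then 1 else of_nat (card A) * t + 1))"

lemma row_sign_insert:
  assumes "finite A" "A \<noteq> {}" "x \<notin> A"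
  shows "row_sign a b (insert x A) = (if x = a \<or> x = b then 0 else - row_sign a b A)"
proof -
  from assms have "card A > 0" by (simp add: card_gt_0_iff)
  \<comment> \<open>A nonempty row makes the truncated subtraction \<open>card A - 1\<close>
    exact.\<close>
  then obtain k where "card A = Suc k" using gr0_conv_Suc by blast
  with assms show ?thesis by (auto simp: row_sign_def)
qed

text \<open>A further ordinary cell flips the sign and raises \<open>k * t + 1\<close> to
  \<open>(k + 1) * t + 1\<close>; the surplus \<open>t\<close> comes with the bare sign, which is
  what \<open>row_sign\<close> records. An extreme letter leaves the bare sign of a row free of
  extremes, and gives 0 on a row holding the other extreme, where \<open>row_sign\<close> vanishes
  as well.\<close>

lemma row_weight_insert:
  assumes "finite A" "A \<noteq> {}" "x \<notin> A" "a \<noteq> b"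
  shows "row_weight t a b (insert x A) =
    (if x = a \<or> x = b then - row_sign a b A else - row_weight t a b A - t * row_sign a b A)"
proof -
  from assms have "card A > 0" by (simp add: card_gt_0_iff)
  then obtain k where "card A = Suc k" using gr0_conv_Suc by blast
  with assms show ?thesis by (auto simp: row_sign_def row_weight_def algebra_simps)
qed

section \<open>Fillings read off from a word, and their rows\<close>

lemma dom_word_filling: "length \<Gamma> = length \<phi> \<Longrightarrow> dom (word_filling \<phi> \<Gamma>) = set \<Gamma>"
  by (simp add: word_filling_def)

lemma word_filling_nth:
  "distinct \<Gamma> \<Longrightarrow> length \<Gamma> = length \<phi> \<Longrightarrow> j < length \<phi> \<Longrightarrow>
   word_filling \<phi> \<Gamma> (\<Gamma> ! j) = Some (\<phi> ! j)"
  by (simp add: word_filling_def map_of_zip_nth)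

lemma word_filling_SomeD:
  "word_filling \<phi> \<Gamma> d = Some x \<Longrightarrow>
   \<exists>j < length \<phi>. j < length \<Gamma> \<and> d = \<Gamma> ! j \<and> x = \<phi> ! j"
  by (auto simp: word_filling_def in_set_zip dest!: map_of_SomeD)

lemma row_values_subset:
  "row_values (word_filling \<phi> \<Gamma>) i \<subseteq> set \<phi>"
  by (auto simp: row_values_def word_filling_def dest!: map_of_SomeD set_zip_rightD)

lemma row_values_row:
  assumes "u \<in> row_values (word_filling \<phi> \<Gamma>) i"
  shows "i \<in> fst ` set \<Gamma>"
proof -
  from assms obtain j where "word_filling \<phi> \<Gamma> (i, j) = Some u"
    by (auto simp: row_values_def)
  from word_filling_SomeD[OF this] have "(i, j) \<in> set \<Gamma>" by (metis nth_mem)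
  then show ?thesis by force
qed

lemma row_values_nonempty:
  assumes "length \<Gamma> = length \<phi>" "c \<in> set \<Gamma>"
  shows "row_values (word_filling \<phi> \<Gamma>) (fst c) \<noteq> {}"
proof -
  from assms have "c \<in> dom (word_filling \<phi> \<Gamma>)"
    by (simp add: word_filling_def)
  then show ?thesis by (cases c) (auto simp: row_values_def)
qed

lemma row_values_Cons:
  assumes "c \<notin> set \<Gamma>"
  shows "row_values (word_filling (x # \<phi>) (c # \<Gamma>)) i =
    (if i = fst c then insert x (row_values (word_filling \<phi> \<Gamma>) i)
     else row_values (word_filling \<phi> \<Gamma>) i)"
proof -
  \<comment> \<open>In \<open>map_of\<close> the first pair wins; a value already stored at
    \<open>c\<close> would be hidden instead of joined by \<open>x\<close>.\<close>
  have "map_of (zip \<Gamma> \<phi>) c = None"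
    using assms by (auto simp: map_of_eq_None_iff dest: set_zip_leftD)
  then show ?thesis
    by (cases c) (force simp: row_values_def word_filling_def)
qed

section \<open>Weights of whole shapes and the effect of prepending a cell\<close>

definition shape_weight :: "'b::comm_ring_1 \<Rightarrow> 'a \<Rightarrow> 'a \<Rightarrow> 'a list \<Rightarrow> cell list \<Rightarrow> 'b" where
  "shape_weight t a b \<phi> \<Gamma> =
     (\<Prod>i\<in>fst ` set \<Gamma>. row_weight t a b (row_values (word_filling \<phi> \<Gamma>) i))"

definition shape_sign :: "'b::comm_ring_1 \<Rightarrow> 'a \<Rightarrow> 'a \<Rightarrow> 'a list \<Rightarrow> cell list \<Rightarrow> 'b" where
  "shape_sign t a b \<phi> \<Gamma> = row_sign a b (row_values (word_filling \<phi> \<Gamma>) (fst (hd \<Gamma>))) *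
     (\<Prod>i\<in>fst ` set \<Gamma> - {fst (hd \<Gamma>)}. row_weight t a b (row_values (word_filling \<phi> \<Gamma>) i))"

lemma row_values_Nil: "row_values (word_filling [] []) i = {}"
  by (simp add: row_values_def word_filling_def)

lemma shape_weight_single:
  assumes "a \<noteq> b"
  shows "shape_weight t a b [x] [c] = (if x = a \<or> x = b then 1 else t + 1)"
    "shape_sign t a b [x] [c] = (if x = a \<or> x = b then 0 else 1)"
  using assms by (auto simp: shape_weight_def shape_sign_def row_values_Cons row_values_Nil
      row_weight_def row_sign_def)

text \<open>The cell \<open>c\<close> lies in a row above all of \<open>\<Gamma>\<close>, so its row
  is the singleton \<open>{x}\<close> and every other factor is unchanged.\<close>

lemma shape_weight_new_row:
  assumes "\<Gamma> \<in> shapes \<tau> d ws" "fst d = fst c + 1" "a \<noteq> b"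
  shows "shape_weight t a b (x # ws) (c # \<Gamma>) =
      (if x = a \<or> x = b then 1 else t + 1) * shape_weight t a b ws \<Gamma>"
    "shape_sign t a b (x # ws) (c # \<Gamma>) =
      (if x = a \<or> x = b then 0 else 1) * shape_weight t a b ws \<Gamma>"
proof -
  have new: "fst c \<notin> fst ` set \<Gamma>"
    using shapes_ge[OF assms(1)] assms(2) by fastforce
  then have c: "c \<notin> set \<Gamma>" by blast
  have "row_values (word_filling ws \<Gamma>) (fst c) = {}"
    using new row_values_row by fast
  then have rv: "row_values (word_filling (x # ws) (c # \<Gamma>)) (fst c) = {x}"
    by (simp add: row_values_Cons[OF c])
  have eq: "(\<Prod>i\<in>fst ` set \<Gamma>. row_weight t a b (row_values (word_filling (x # ws) (c # \<Gamma>)) i)) =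
      shape_weight t a b ws \<Gamma>"
    unfolding shape_weight_def
  proof (rule prod.cong[OF refl])
    fix i assume "i \<in> fst ` set \<Gamma>"
    with new have "i \<noteq> fst c" by blast
    then show "row_weight t a b (row_values (word_filling (x # ws) (c # \<Gamma>)) i) =
        row_weight t a b (row_values (word_filling ws \<Gamma>) i)"
      by (simp add: row_values_Cons[OF c])
  qed
  show "shape_weight t a b (x # ws) (c # \<Gamma>) =
      (if x = a \<or> x = b then 1 else t + 1) * shape_weight t a b ws \<Gamma>"
    using new assms(3) unfolding shape_weight_def[of t a b "x # ws"]
    by (simp add: rv eq) (auto simp: row_weight_def)
  show "shape_sign t a b (x # ws) (c # \<Gamma>) =
      (if x = a \<or> x = b then 0 else 1) * shape_weight t a b ws \<Gamma>"
    using new assms(3) unfolding shape_sign_def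
    by (simp add: rv eq) (auto simp: row_sign_def)
qed

text \<open>Only the row of \<open>c\<close> changes, and it is also the first row of
  \<open>\<Gamma>\<close>. The other rows give a common factor \<open>Q\<close>, so the rules for
  inserting a value into a row carry over.\<close>

lemma shape_weight_same_row:
  assumes "\<Gamma> \<in> shapes \<tau> d ws" "fst d = fst c" "snd d = snd c + 1" "a \<noteq> b" "x \<notin> set ws"
  shows "shape_weight t a b (x # ws) (c # \<Gamma>) = (if x = a \<or> x = b then - shape_sign t a b ws \<Gamma>
      else - shape_weight t a b ws \<Gamma> - t * shape_sign t a b ws \<Gamma>)"
    "shape_sign t a b (x # ws) (c # \<Gamma>) =
      (if x = a \<or> x = b then 0 else - shape_sign t a b ws \<Gamma>)"
proof -
  have d: "hd \<Gamma> = d" "d \<in> set \<Gamma>"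
    using shapes_hd[OF assms(1)] hd_in_set by auto
  have c: "c \<notin> set \<Gamma>"
    using shapes_ge[OF assms(1)] assms(3) by fastforce
  have row: "fst c \<in> fst ` set \<Gamma>"
    using d assms(2) by (metis imageI)
  define A where "A = row_values (word_filling ws \<Gamma>) (fst c)"
  have A: "finite A" "A \<noteq> {}" "x \<notin> A"
    using row_values_subset[of ws \<Gamma> "fst c"] assms(5)
      row_values_nonempty[OF shapes_length[OF assms(1)] d(2)]
    by (auto simp: A_def assms(2) intro: finite_subset)
  have rv: "row_values (word_filling (x # ws) (c # \<Gamma>)) (fst c) = insert x A"
    by (simp add: row_values_Cons[OF c] A_def)
  define Q where "Q = (\<Prod>i\<in>fst ` set \<Gamma> - {fst c}. row_weight t a b (row_values (word_filling ws \<Gamma>) i))"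
  have eq: "(\<Prod>i\<in>fst ` set \<Gamma> - {fst c}.
      row_weight t a b (row_values (word_filling (x # ws) (c # \<Gamma>)) i)) = Q"
    unfolding Q_def by (rule prod.cong) (auto simp: row_values_Cons[OF c])
  have W: "shape_weight t a b ws \<Gamma> = row_weight t a b A * Q"
    unfolding shape_weight_def Q_def A_def using row by (subst prod.remove[of _ "fst c"]) auto
  have V: "shape_sign t a b ws \<Gamma> = row_sign a b A * Q"
    by (simp add: shape_sign_def Q_def A_def d assms(2))
  have "shape_weight t a b (x # ws) (c # \<Gamma>) = row_weight t a b (insert x A) * Q"
    unfolding shape_weight_def using row
    by (subst prod.remove[of _ "fst c"]) (auto simp: insert_absorb eq rv)
  then show "shape_weight t a b (x # ws) (c # \<Gamma>) = (if x = a \<or> x = b then - shape_sign t a b ws \<Gamma>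
      else - shape_weight t a b ws \<Gamma> - t * shape_sign t a b ws \<Gamma>)"
    by (simp add: W V row_weight_insert[OF A assms(4)] algebra_simps)
  have "shape_sign t a b (x # ws) (c # \<Gamma>) = row_sign a b (insert x A) * Q"
    unfolding shape_sign_def using row by (simp add: insert_absorb eq rv)
  then show "shape_sign t a b (x # ws) (c # \<Gamma>) =
      (if x = a \<or> x = b then 0 else - shape_sign t a b ws \<Gamma>)"
    by (simp add: V row_sign_insert[OF A])
qed

section \<open>The recursion for the signed sums\<close>

definition weight_sum :: "'b::comm_ring_1 \<Rightarrow> 'a \<Rightarrow> 'a \<Rightarrow> 'a list \<Rightarrow> cell \<Rightarrow> 'a list \<Rightarrow> 'b" where
  "weight_sum t a b \<tau> c ws = (\<Sum>\<Gamma>\<in>shapes \<tau> c ws. shape_weight t a b ws \<Gamma>)"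

definition sign_sum :: "'b::comm_ring_1 \<Rightarrow> 'a \<Rightarrow> 'a \<Rightarrow> 'a list \<Rightarrow> cell \<Rightarrow> 'a list \<Rightarrow> 'b" where
  "sign_sum t a b \<tau> c ws = (\<Sum>\<Gamma>\<in>shapes \<tau> c ws. shape_sign t a b ws \<Gamma>)"

lemma sums_descent:
  assumes "prec \<tau> y x" "a \<noteq> b"
  shows "weight_sum t a b \<tau> c (x # y # ws) =
      (if x = a \<or> x = b then 1 else t + 1) * weight_sum t a b \<tau> (fst c + 1, snd c) (y # ws)"
    "sign_sum t a b \<tau> c (x # y # ws) =
      (if x = a \<or> x = b then 0 else 1) * weight_sum t a b \<tau> (fst c + 1, snd c) (y # ws)"
proof -
  note new = shape_weight_new_row[of _ \<tau> "(fst c + 1, snd c)" "y # ws" c a b, OF _ _ assms(2)]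
  show "weight_sum t a b \<tau> c (x # y # ws) =
      (if x = a \<or> x = b then 1 else t + 1) * weight_sum t a b \<tau> (fst c + 1, snd c) (y # ws)"
    using assms(1) unfolding weight_sum_def sum_distrib_left
    by (simp add: sum.reindex) (intro sum.cong refl conjI impI; simp add: new)
  show "sign_sum t a b \<tau> c (x # y # ws) =
      (if x = a \<or> x = b then 0 else 1) * weight_sum t a b \<tau> (fst c + 1, snd c) (y # ws)"
    using assms(1) unfolding weight_sum_def sign_sum_def sum_distrib_left
    by (simp add: sum.reindex) (intro sum.cong sum.neutral refl conjI impI ballI; simp add: new)
qed

text \<open>The east step extends the row of \<open>c\<close> and the southeast step opens a new
  row, so the sums on the right start at two different cells. They can be merged only once a closed
  form shows that the start cell does not matter.\<close>

lemma sums_ascent: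
  fixes c :: cell
  assumes "\<not> prec \<tau> y x" "a \<noteq> b" "x \<notin> set (y # ws)"
  defines "e \<equiv> (fst c, snd c + 1)" and "s \<equiv> (fst c + 1, snd c + 1)"
  shows "weight_sum t a b \<tau> c (x # y # ws) =
      (if x = a \<or> x = b
       then weight_sum t a b \<tau> s (y # ws) - sign_sum t a b \<tau> e (y # ws)
       else (t + 1) * weight_sum t a b \<tau> s (y # ws) - weight_sum t a b \<tau> e (y # ws)
         - t * sign_sum t a b \<tau> e (y # ws))"
    "sign_sum t a b \<tau> c (x # y # ws) =
      (if x = a \<or> x = b then 0
       else weight_sum t a b \<tau> s (y # ws) - sign_sum t a b \<tau> e (y # ws))"
proof -
  let ?E = "shapes \<tau> e (y # ws)" and ?S = "shapes \<tau> s (y # ws)"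
  have split: "sum g (shapes \<tau> c (x # y # ws)) =
      (\<Sum>\<Gamma>\<in>?E. g (c # \<Gamma>)) + (\<Sum>\<Gamma>\<in>?S. g (c # \<Gamma>))" for g :: "cell list \<Rightarrow> 'b"
  proof -
    \<comment> \<open>The two families differ in their first cell.\<close>
    have "?E \<inter> ?S = {}"
      using shapes_hd[of _ \<tau> e] shapes_hd[of _ \<tau> s] by (fastforce simp: e_def s_def)
    then show ?thesis
      using assms(1) by (simp add: sum.reindex sum.union_disjoint finite_shapes e_def s_def)
  qed
  note new = shape_weight_new_row[of _ \<tau> s "y # ws" c a b, OF _ _ assms(2)]
  note same = shape_weight_same_row[of _ \<tau> e "y # ws" c a b, OF _ _ _ assms(2,3)]
  have E: "fst e = fst c" "snd e = snd c + 1" and S: "fst s = fst c + 1"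
    by (simp_all add: e_def s_def)
  show "weight_sum t a b \<tau> c (x # y # ws) =
      (if x = a \<or> x = b
       then weight_sum t a b \<tau> s (y # ws) - sign_sum t a b \<tau> e (y # ws)
       else (t + 1) * weight_sum t a b \<tau> s (y # ws) - weight_sum t a b \<tau> e (y # ws)
         - t * sign_sum t a b \<tau> e (y # ws))"
    unfolding weight_sum_def sign_sum_def split sum_distrib_left
    by (simp add: new same E S sum_negf sum_subtractf cong: sum.cong)
  show "sign_sum t a b \<tau> c (x # y # ws) =
      (if x = a \<or> x = b then 0
       else weight_sum t a b \<tau> s (y # ws) - sign_sum t a b \<tau> e (y # ws))"
    unfolding weight_sum_def sign_sum_def split
    by (simp add: new same E S sum_negf cong: sum.cong)
qed

section \<open>Elementary properties of the order given by \<open>\<tau>\<close>\<close>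

lemma prec_trans: "distinct \<tau> \<Longrightarrow> prec \<tau> x y \<Longrightarrow> prec \<tau> y z \<Longrightarrow> prec \<tau> x z"
  unfolding prec_def by (metis nth_eq_iff_index_eq order.strict_trans)

lemma prec_asym: "distinct \<tau> \<Longrightarrow> prec \<tau> x y \<Longrightarrow> \<not> prec \<tau> y x"
  unfolding prec_def by (metis nth_eq_iff_index_eq order.strict_trans less_irrefl)

lemma prec_total: "x \<in> set \<tau> \<Longrightarrow> y \<in> set \<tau> \<Longrightarrow> x \<noteq> y \<Longrightarrow> prec \<tau> x y \<or> prec \<tau> y x"
  unfolding prec_def by (metis in_set_conv_nth linorder_neqE_nat)

lemma not_prec_smallest: "distinct \<tau> \<Longrightarrow> \<not> prec \<tau> x (smallest \<tau>)"
  unfolding prec_def smallest_def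
  by (metis hd_conv_nth list.size(3) nth_eq_iff_index_eq not_less_zero gr_implies_not0 length_greater_0_conv)

lemma not_prec_largest: "distinct \<tau> \<Longrightarrow> \<not> prec \<tau> (largest \<tau>) x"
proof
  assume "distinct \<tau>" "prec \<tau> (largest \<tau>) x"
  then obtain i j where ij: "i < j" "j < length \<tau>" "\<tau> ! i = last \<tau>"
    by (auto simp: prec_def largest_def)
  then have "\<tau> ! i = \<tau> ! (length \<tau> - 1)" by (metis last_conv_nth list.size(3) not_less0)
  then have "i = length \<tau> - 1"
    using \<open>distinct \<tau>\<close> ij by (subst (asm) nth_eq_iff_index_eq) auto
  with ij show False by linarith
qed

lemma smallest_neq_largest: "distinct \<tau> \<Longrightarrow> length \<tau> \<ge> 2 \<Longrightarrow> smallest \<tau> \<noteq> largest \<tau>"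
  by (cases \<tau>) (auto simp: smallest_def largest_def split: if_splits)

section \<open>Evaluation of the sums along rising runs\<close>

text \<open>This is the left side of the theorem restricted to one run. For length at least 2 the
  exponent of \<open>t\<close> is the length, less its contribution \<open>length r - 2\<close> to
  \<open>mt\<close>, less the number of extreme letters present; that leaves one for each missing
  extreme.\<close>

definition run_weight :: "'b::comm_ring_1 \<Rightarrow> 'a \<Rightarrow> 'a \<Rightarrow> 'a list \<Rightarrow> 'b" where
  "run_weight t a b r =
     (if length r = 1 then if a \<in> set r \<or> b \<in> set r then 1 else t + 1
      else (t - 1) ^ (length r - 2) * t ^ (of_bool (a \<notin> set r) + of_bool (b \<notin> set r)))"

text \<open>The second conjunct carries the induction: an ascent multiplies the difference of the
  two sums by \<open>t - 1\<close>, or makes it the new weight sum when the smallest letter is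
  prepended. A word starting with \<open>a\<close> needs no such claim, since nothing ascends to the
  smallest letter. The right sides are free of \<open>c\<close>, which gives the independence of the
  start cell.\<close>

lemma weight_sum_eq:
  fixes t :: "'b::comm_ring_1" and \<tau> :: "'a list"
  defines "a \<equiv> smallest \<tau>" and "b \<equiv> largest \<tau>"
  assumes \<tau>: "distinct \<tau>" "length \<tau> \<ge> 2"
    and "ws \<noteq> []" "distinct ws" "set ws \<subseteq> set \<tau>"
  shows "weight_sum t a b \<tau> c ws = prod_list (map (run_weight t a b) (rising_runs \<tau> ws)) \<and>
    (hd ws \<noteq> a \<longrightarrow> a \<notin> set (hd (rising_runs \<tau> ws)) \<and>
      weight_sum t a b \<tau> c ws - sign_sum t a b \<tau> c ws =
        (t - 1) ^ (length (hd (rising_runs \<tau> ws)) - 1) *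
        t ^ of_bool (b \<notin> set (hd (rising_runs \<tau> ws))) *
        prod_list (map (run_weight t a b) (tl (rising_runs \<tau> ws))))"
  using assms(5-)
proof (induction ws arbitrary: c rule: induct_list012)
  case 1
  then show ?case by simp
next
  case (2 x)
  have "a \<noteq> b" using smallest_neq_largest[OF \<tau>] by (simp add: a_def b_def)
  then show ?case
    by (auto simp: weight_sum_def sign_sum_def shape_weight_single run_weight_def)
next
  case (3 x y ws)
  have ab: "a \<noteq> b" using smallest_neq_largest[OF \<tau>] by (simp add: a_def b_def)
  define r R where "r = hd (rising_runs \<tau> (y # ws))" and "R = tl (rising_runs \<tau> (y # ws))"
  have runs: "rising_runs \<tau> (y # ws) = r # R"
    using rising_runs_neq_Nil[of "y # ws" \<tau>] by (simp add: r_def R_def)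
  then have "r \<noteq> []" using Nil_notin_rising_runs[of \<tau> "y # ws"] by auto
  define P where "P = prod_list (map (run_weight t a b) R)"
  have IH: "weight_sum t a b \<tau> c (y # ws) = run_weight t a b r * P"
    "y \<noteq> a \<Longrightarrow> a \<notin> set r"
    "y \<noteq> a \<Longrightarrow> weight_sum t a b \<tau> c (y # ws) - sign_sum t a b \<tau> c (y # ws) =
        (t - 1) ^ (length r - 1) * t ^ of_bool (b \<notin> set r) * P" for c
    using "3.IH"(2)[of c] "3.prems" unfolding P_def runs list.sel by auto
  show ?case
  proof (cases "prec \<tau> y x")
    case True
    \<comment> \<open>Here \<open>x\<close> forms a run of its own. The difference of its sums is
      the remaining weight sum times \<open>t\<close>, or times 1 if \<open>x\<close> is the largest
      letter.\<close>
    then have "x \<noteq> a" using not_prec_smallest[OF \<tau>(1)] by (auto simp: a_def)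
    then have x: "run_weight t a b [x] = (if x = b then 1 else t + 1)"
      by (auto simp: run_weight_def)
    show ?thesis
      using \<open>x \<noteq> a\<close> True
      by (auto simp: sums_descent[OF True ab] runs IH(1) x P_def algebra_simps)
  next
    case False
    then have "prec \<tau> x y" using prec_total[of x \<tau> y] "3.prems" by auto
    \<comment> \<open>An ascent excludes \<open>y\<close> as smallest and \<open>x\<close> as
      largest letter, so the claim on the difference is available for \<open>y # ws\<close>.\<close>
    then have ya: "y \<noteq> a" and xb: "x \<noteq> b"
      using not_prec_smallest[OF \<tau>(1)] not_prec_largest[OF \<tau>(1)] by (auto simp: a_def b_def)
    obtain k where k: "length r = Suc k" using \<open>r \<noteq> []\<close> by (cases r) auto
    define D where "D = (t - 1) ^ k * t ^ of_bool (b \<notin> set r) * P"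
    have T: "sign_sum t a b \<tau> c (y # ws) = run_weight t a b r * P - D" for c
      using IH(3)[OF ya, of c] by (simp add: IH(1) D_def k algebra_simps)
    \<comment> \<open>For an ordinary \<open>x\<close> the weight sum is
      \<open>(t + 1) * W - W - t * T = t * (W - T)\<close>, where \<open>W\<close> and
      \<open>T\<close> are the two sums of \<open>y # ws\<close> and \<open>W - T = D\<close>. The
      new difference is then \<open>(t - 1) * D\<close>.\<close>
    have sums: "weight_sum t a b \<tau> c (x # y # ws) = (if x = a then D else t * D)"
      "sign_sum t a b \<tau> c (x # y # ws) = (if x = a then 0 else D)"
      using "3.prems" xb by (simp_all add: sums_ascent[OF False ab] T IH(1) algebra_simps)
    have xr: "run_weight t a b (x # r) =
        (t - 1) ^ k * t ^ (of_bool (x \<noteq> a) + of_bool (b \<notin> set r))"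
      using k xb IH(2)[OF ya] by (simp add: run_weight_def)
    have runs': "rising_runs \<tau> (x # y # ws) = (x # r) # R"
      using False by (simp add: runs)
    have "a \<notin> set (x # r) \<longleftrightarrow> x \<noteq> a" "b \<notin> set (x # r) \<longleftrightarrow> b \<notin> set r" "length (x # r) - 1 = Suc k"
      "a \<notin> set r" using IH(2)[OF ya] xb k by auto
    then show ?thesis
      unfolding runs' sums list.sel list.map prod_list.Cons xr P_def[symmetric]
      by (simp add: D_def power_add algebra_simps)
  qed
qed

section \<open>Collecting the exponents over all runs\<close>

text \<open>All exponents add up over the runs. Disjointness of the runs makes the number of extreme
  letters additive, and \<open>mt_io_le_aux\<close> guarantees that the subtractions in the exponent
  of \<open>t\<close> are never truncated.\<close>

lemma prod_list_run_weight:
  assumes "[] \<notin> set rs" "distinct (concat rs)" "a \<noteq> b"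
  shows "prod_list (map (run_weight t a b) rs) =
    (t - 1) ^ (\<Sum>r \<leftarrow> filter (\<lambda>r. length r > 1) rs. length r - 2) *
    t ^ (length (concat rs) - card ({a, b} \<inter> set (concat rs))
      - (\<Sum>r \<leftarrow> filter (\<lambda>r. length r > 1) rs. length r - 2)
      - length (filter (\<lambda>r. length r = 1 \<and> a \<notin> set r \<and> b \<notin> set r) rs)) *
    (t + 1) ^ length (filter (\<lambda>r. length r = 1 \<and> a \<notin> set r \<and> b \<notin> set r) rs)"
  using assms(1,2)
proof (induction rs)
  case Nil
  then show ?case by simp
next
  case (Cons r rs)
  define M where "M rs = (\<Sum>r \<leftarrow> filter (\<lambda>r. length r > 1) rs. length r - 2)" for rs :: "'a list list"
  define I where "I rs = length (filter (\<lambda>r. length r = 1 \<and> a \<notin> set r \<and> b \<notin> set r) rs)" for rs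
  define C where "C rs = card ({a, b} \<inter> set (concat rs))" for rs
  define L :: "'a list list \<Rightarrow> nat" where "L rs = length (concat rs)" for rs
  have bound: "M rs + I rs + C rs \<le> L rs" if "[] \<notin> set rs" for rs
    using mt_io_le_aux[OF that, of a b] by (simp add: M_def I_def C_def L_def)
  \<comment> \<open>The claim for the one-element list \<open>[r]\<close>; what remains is
    additivity in the list of runs.\<close>
  have hd: "run_weight t a b r =
      (t - 1) ^ M [r] * t ^ (L [r] - C [r] - M [r] - I [r]) * (t + 1) ^ I [r]"
  proof (cases "length r = 1")
    case True
    then show ?thesis using assms(3)
      by (auto simp: run_weight_def M_def L_def C_def I_def length_Suc_conv)
  next
    case False
    with Cons.prems obtain k where "length r = Suc (Suc k)"
      by (cases r; cases "tl r") auto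
    then show ?thesis using assms(3)
      by (auto simp: run_weight_def M_def L_def C_def I_def Int_insert_left power2_eq_square)
  qed
  have C: "C (r # rs) = C [r] + C rs"
  proof -
    have "{a, b} \<inter> set (concat (r # rs)) = ({a, b} \<inter> set r) \<union> ({a, b} \<inter> set (concat rs))"
      by auto
    then show ?thesis
      using Cons.prems by (auto simp: C_def intro!: card_Un_disjoint)
  qed
  have add: "M (r # rs) = M [r] + M rs" "I (r # rs) = I [r] + I rs" "L (r # rs) = L [r] + L rs"
    by (simp_all add: M_def I_def L_def)
  have e: "L (r # rs) - C (r # rs) - M (r # rs) - I (r # rs) =
      (L [r] - C [r] - M [r] - I [r]) + (L rs - C rs - M rs - I rs)"
    using bound[of rs] bound[of "[r]"] Cons.prems by (simp add: C add)
  have IH: "prod_list (map (run_weight t a b) rs) =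
      (t - 1) ^ M rs * t ^ (L rs - C rs - M rs - I rs) * (t + 1) ^ I rs"
    using Cons by (simp add: M_def I_def C_def L_def)
  have "prod_list (map (run_weight t a b) (r # rs)) =
      (t - 1) ^ M (r # rs) * t ^ (L (r # rs) - C (r # rs) - M (r # rs) - I (r # rs)) *
      (t + 1) ^ I (r # rs)"
    unfolding e by (simp add: hd IH add power_add mult_ac)
  then show ?case by (simp only: M_def I_def C_def L_def)
qed

section \<open>The enumerated shapes are exactly the fitted ribbons\<close>

lemma word_filling_Cons: "word_filling (x # \<phi>) (c # \<Gamma>) = (word_filling \<phi> \<Gamma>)(c \<mapsto> x)"
  by (simp add: word_filling_def)

text \<open>The conditions on consecutive letters imply the global ones by transitivity through
  \<open>y\<close>: another cell in the row of \<open>c\<close> exists only if the first step goes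
  east, another cell in its column only if that step goes south.\<close>

lemma shapes_increasing:
  assumes "distinct \<tau>"
  shows "\<Gamma> \<in> shapes \<tau> c ws \<Longrightarrow> distinct ws \<Longrightarrow> set ws \<subseteq> set \<tau> \<Longrightarrow>
    (\<forall>i j j' u v. j < j' \<and> word_filling ws \<Gamma> (i, j) = Some u \<and>
       word_filling ws \<Gamma> (i, j') = Some v \<longrightarrow> prec \<tau> u v) \<and>
    (\<forall>i i' j u v. i < i' \<and> word_filling ws \<Gamma> (i, j) = Some u \<and>
       word_filling ws \<Gamma> (i', j) = Some v \<longrightarrow> prec \<tau> v u)"
  using assms
proof (induction \<tau> c ws arbitrary: \<Gamma> rule: shapes.induct)
  case (1 \<tau> c)
  then show ?case by simp
next
  case (2 \<tau> c x)
  then show ?case by (auto simp: word_filling_def split: if_splits)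
next
  case (3 \<tau> c x y ws)
  from "3.prems" obtain d \<Gamma>' where \<Gamma>: "\<Gamma> = c # \<Gamma>'" and \<Gamma>': "\<Gamma>' \<in> shapes \<tau> d (y # ws)"
    and d: "if prec \<tau> y x then d = (fst c + 1, snd c)
            else d = (fst c, snd c + 1) \<or> d = (fst c + 1, snd c + 1)"
    by (fastforce split: if_splits)
  define g where "g = word_filling (y # ws) \<Gamma>'"
  have xy: "prec \<tau> x y \<or> prec \<tau> y x"
    using prec_total[of x \<tau> y] "3.prems" by auto
  have "hd \<Gamma>' = d" "\<Gamma>' \<noteq> []" using shapes_hd[OF \<Gamma>'] by auto
  then have gd: "g d = Some y" by (cases \<Gamma>') (auto simp: g_def word_filling_Cons)
  have ge: "fst d \<le> i \<and> snd d \<le> j" if "g (i, j) = Some u" for i j u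
  proof -
    from word_filling_SomeD[OF that[unfolded g_def]] obtain k
      where "k < length \<Gamma>'" "(i, j) = \<Gamma>' ! k" by blast
    then have "(i, j) \<in> set \<Gamma>'" by (metis nth_mem)
    from shapes_ge[OF \<Gamma>' this] show ?thesis by simp
  qed
  have IH: "j < j' \<Longrightarrow> g (i, j) = Some u \<Longrightarrow> g (i, j') = Some v \<Longrightarrow> prec \<tau> u v"
    "i < i' \<Longrightarrow> g (i, j) = Some u \<Longrightarrow> g (i', j) = Some v \<Longrightarrow> prec \<tau> v u" for i i' j j' u v
  proof -
    have prems: "distinct (y # ws)" "set (y # ws) \<subseteq> set \<tau>" using "3.prems" by auto
    have "(\<forall>i j j' u v. j < j' \<and> g (i, j) = Some u \<and> g (i, j') = Some v \<longrightarrow> prec \<tau> u v) \<and>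
      (\<forall>i i' j u v. i < i' \<and> g (i, j) = Some u \<and> g (i', j) = Some v \<longrightarrow> prec \<tau> v u)"
    proof (cases "prec \<tau> y x")
      case True
      then show ?thesis
        using "3.IH"(1)[OF True _ prems "3.prems"(4)] \<Gamma>' d unfolding g_def by auto
    next
      case False
      with d consider "d = (fst c, snd c + 1)" | "d = (fst c + 1, snd c + 1)" by auto
      then show ?thesis
        using "3.IH"(2,3)[OF False _ prems "3.prems"(4)] \<Gamma>' unfolding g_def by cases auto
    qed
    then show "j < j' \<Longrightarrow> g (i, j) = Some u \<Longrightarrow> g (i, j') = Some v \<Longrightarrow> prec \<tau> u v"
      "i < i' \<Longrightarrow> g (i, j) = Some u \<Longrightarrow> g (i', j) = Some v \<Longrightarrow> prec \<tau> v u" by blast+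
  qed
  have eq: "word_filling (x # y # ws) \<Gamma> = g(c \<mapsto> x)"
    by (simp add: \<Gamma> word_filling_Cons g_def)
  have "prec \<tau> u v" if "j < j'" "(g(c \<mapsto> x)) (i, j) = Some u" "(g(c \<mapsto> x)) (i, j') = Some v"
    for i j j' u v
  proof (cases "c = (i, j)")
    case True
    with that have "u = x" and v: "g (i, j') = Some v" by auto
    \<comment> \<open>The rest of the shape lies weakly southeast of \<open>d\<close>, so a value in
      the row of \<open>c\<close> forces \<open>d\<close> into that row.\<close>
    from ge[OF v] d True have de: "d = (i, j + 1)" and "prec \<tau> x y"
      using xy by (auto split: if_splits)
    moreover have "j' = j + 1 \<or> j + 1 < j'" using that by linarith
    ultimately show ?thesis
      using \<open>u = x\<close> v gd IH(1)[of "j + 1" j' i y v] prec_trans[OF "3.prems"(4)] by auto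
  next
    case False
    with that have u: "g (i, j) = Some u" by auto
    moreover have "c \<noteq> (i, j')" using ge[OF u] that(1) d by (auto split: if_splits)
    ultimately show ?thesis using that IH(1) by auto
  qed
  moreover have "prec \<tau> v u" if "i < i'" "(g(c \<mapsto> x)) (i, j) = Some u" "(g(c \<mapsto> x)) (i', j) = Some v"
    for i i' j u v
  proof (cases "c = (i, j)")
    case True
    with that have "u = x" and v: "g (i', j) = Some v" by auto
    from ge[OF v] d True have de: "d = (i + 1, j)" and "prec \<tau> y x"
      by (auto split: if_splits)
    moreover have "i' = i + 1 \<or> i + 1 < i'" using that by linarith
    ultimately show ?thesis
      using \<open>u = x\<close> v gd IH(2)[of "i + 1" i' j y v] prec_trans[OF "3.prems"(4)] by auto
  next
    case False
    with that have u: "g (i, j) = Some u" by auto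
    moreover have "c \<noteq> (i', j)" using ge[OF u] that(1) d by (auto split: if_splits)
    ultimately show ?thesis using that IH(2) by auto
  qed
  ultimately show ?case unfolding eq by blast
qed

text \<open>Standardness turns an east step into an ascent and a south step into a descent, and
  fitting turns a southeast step into an ascent. By asymmetry of the order the letters then decide
  whether a step is south.\<close>

lemma shapes_eq_fits:
  assumes "distinct \<tau>" "distinct \<phi>" "set \<phi> = set \<tau>" "\<phi> \<noteq> []"
  shows "shapes \<tau> (1, 1) \<phi> = {\<Gamma>. skew_ribbon \<Gamma> \<and> fits \<tau> \<phi> \<Gamma>}"
proof (intro set_eqI iffI)
  fix \<Gamma> assume \<Gamma>: "\<Gamma> \<in> shapes \<tau> (1, 1) \<phi>"
  note len = shapes_length[OF \<Gamma>] and dist = shapes_distinct[OF \<Gamma>]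
  have start: "\<Gamma> \<noteq> []" "hd \<Gamma> = (1, 1)"
    and step: "Suc j < length \<Gamma> \<Longrightarrow> if prec \<tau> (\<phi> ! Suc j) (\<phi> ! j)
      then south_of (\<Gamma> ! j) (\<Gamma> ! Suc j)
      else east_of (\<Gamma> ! j) (\<Gamma> ! Suc j) \<or> southeast_of (\<Gamma> ! j) (\<Gamma> ! Suc j)" for j
    using \<Gamma> unfolding shapes_iff by auto
  \<comment> \<open>Reading the filling along the ribbon returns the word; injectivity and image of
    the filling follow from those of \<open>\<phi>\<close>.\<close>
  have "map (\<lambda>c. the (word_filling \<phi> \<Gamma> c)) \<Gamma> = \<phi>"
    by (rule nth_equalityI) (simp_all add: len word_filling_nth[OF dist len])
  with assms(2,3) have "inj_on (\<lambda>c. the (word_filling \<phi> \<Gamma> c)) (set \<Gamma>)"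
    and "(\<lambda>c. the (word_filling \<phi> \<Gamma> c)) ` set \<Gamma> = set \<tau>"
    using distinct_map[of "\<lambda>c. the (word_filling \<phi> \<Gamma> c)" \<Gamma>]
      list.set_map[of "\<lambda>c. the (word_filling \<phi> \<Gamma> c)" \<Gamma>] by simp_all
  then have "bij_betw (\<lambda>c. the (word_filling \<phi> \<Gamma> c)) (set \<Gamma>) (set \<tau>)"
    by (rule bij_betw_imageI)
  then have "standard_filling \<tau> \<Gamma> (word_filling \<phi> \<Gamma>)"
    unfolding standard_filling_def
    using shapes_increasing[OF assms(1) \<Gamma> assms(2)] dom_word_filling[OF len] assms(3)
    by (intro conjI) simp_all
  moreover have "prec \<tau> (\<phi> ! j) (\<phi> ! Suc j)"
    if "Suc j < length \<Gamma>" "southeast_of (\<Gamma> ! j) (\<Gamma> ! Suc j)" for j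
  proof -
    have "\<not> prec \<tau> (\<phi> ! Suc j) (\<phi> ! j)"
      using step[OF that(1)] that(2) by (auto simp: southeast_of_def south_of_def split: if_splits)
    moreover have "\<phi> ! j \<in> set \<tau>" "\<phi> ! Suc j \<in> set \<tau>" "\<phi> ! j \<noteq> \<phi> ! Suc j"
      using that assms len by (auto simp: nth_eq_iff_index_eq simp flip: assms(3))
    ultimately show ?thesis using prec_total[of "\<phi> ! j" \<tau> "\<phi> ! Suc j"] by blast
  qed
  moreover have "skew_ribbon \<Gamma>"
    unfolding skew_ribbon_def
  proof (intro conjI allI impI)
    fix j assume "Suc j < length \<Gamma>"
    from step[OF this] show "east_of (\<Gamma> ! j) (\<Gamma> ! Suc j) \<or> south_of (\<Gamma> ! j) (\<Gamma> ! Suc j) \<or>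
        southeast_of (\<Gamma> ! j) (\<Gamma> ! Suc j)"
      by (cases "prec \<tau> (\<phi> ! Suc j) (\<phi> ! j)") auto
  qed (fact start)+
  ultimately show "\<Gamma> \<in> {\<Gamma>. skew_ribbon \<Gamma> \<and> fits \<tau> \<phi> \<Gamma>}"
    unfolding fits_def using len by blast
next
  fix \<Gamma> assume "\<Gamma> \<in> {\<Gamma>. skew_ribbon \<Gamma> \<and> fits \<tau> \<phi> \<Gamma>}"
  then have sk: "skew_ribbon \<Gamma>" and len: "length \<Gamma> = length \<phi>"
    and std: "standard_filling \<tau> \<Gamma> (word_filling \<phi> \<Gamma>)"
    and se: "Suc j < length \<Gamma> \<Longrightarrow> southeast_of (\<Gamma> ! j) (\<Gamma> ! Suc j) \<Longrightarrow>
               prec \<tau> (\<phi> ! j) (\<phi> ! Suc j)" for j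
    by (auto simp: fits_def)
  have "bij_betw (\<lambda>c. the (word_filling \<phi> \<Gamma> c)) (set \<Gamma>) (set \<tau>)"
    using std unfolding standard_filling_def by (elim conjE)
  \<comment> \<open>\<open>skew_ribbon\<close> does not state that the cells are distinct; here this
    follows by counting, as \<open>\<Gamma>\<close> has the length of \<open>\<phi>\<close>.\<close>
  then have "card (set \<Gamma>) = card (set \<phi>)"
    unfolding assms(3) by (rule bij_betw_same_card)
  then have dist: "distinct \<Gamma>"
    using assms(2) len by (simp add: distinct_card card_distinct)
  note nth = word_filling_nth[OF dist len]
  have "if prec \<tau> (\<phi> ! Suc j) (\<phi> ! j) then south_of (\<Gamma> ! j) (\<Gamma> ! Suc j)
         else east_of (\<Gamma> ! j) (\<Gamma> ! Suc j) \<or> southeast_of (\<Gamma> ! j) (\<Gamma> ! Suc j)"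
    if j: "Suc j < length \<Gamma>" for j
  proof -
    have val: "word_filling \<phi> \<Gamma> (fst (\<Gamma> ! j), snd (\<Gamma> ! j)) = Some (\<phi> ! j)"
      "word_filling \<phi> \<Gamma> (fst (\<Gamma> ! Suc j), snd (\<Gamma> ! Suc j)) = Some (\<phi> ! Suc j)"
      using j len nth by auto
    have "prec \<tau> (\<phi> ! j) (\<phi> ! Suc j)" if "east_of (\<Gamma> ! j) (\<Gamma> ! Suc j)"
    proof -
      have "fst (\<Gamma> ! Suc j) = fst (\<Gamma> ! j)" "snd (\<Gamma> ! j) < snd (\<Gamma> ! Suc j)"
        using that by (auto simp: east_of_def)
      then show ?thesis using std val unfolding standard_filling_def by metis
    qed
    moreover have "prec \<tau> (\<phi> ! Suc j) (\<phi> ! j)" if "south_of (\<Gamma> ! j) (\<Gamma> ! Suc j)"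
    proof -
      have "snd (\<Gamma> ! Suc j) = snd (\<Gamma> ! j)" "fst (\<Gamma> ! j) < fst (\<Gamma> ! Suc j)"
        using that by (auto simp: south_of_def)
      then show ?thesis using std val unfolding standard_filling_def by metis
    qed
    ultimately show ?thesis
      using sk j se[OF j] prec_asym[OF assms(1)] unfolding skew_ribbon_def by metis
  qed
  then show "\<Gamma> \<in> shapes \<tau> (1, 1) \<phi>"
    using sk len by (simp add: shapes_iff skew_ribbon_def)
qed

section \<open>From sums over shapes to the sum over fillings\<close>

text \<open>The letters are distinct, so a filling shows in which cell each letter of
  \<open>\<phi>\<close> stands and thus the cell list. This is needed because \<open>Phi\<close>
  collects fillings and not shapes.\<close>

lemma inj_on_word_filling:
  assumes "distinct \<phi>"
  shows "inj_on (word_filling \<phi>) (shapes \<tau> c \<phi>)"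
proof (rule inj_onI)
  fix \<Gamma> \<Delta>
  assume \<Gamma>: "\<Gamma> \<in> shapes \<tau> c \<phi>" and \<Delta>: "\<Delta> \<in> shapes \<tau> c \<phi>"
    and eq: "word_filling \<phi> \<Gamma> = word_filling \<phi> \<Delta>"
  note len = shapes_length[OF \<Gamma>] shapes_length[OF \<Delta>]
  show "\<Gamma> = \<Delta>"
  proof (rule nth_equalityI)
    fix i assume i: "i < length \<Gamma>"
    have "word_filling \<phi> \<Delta> (\<Gamma> ! i) = Some (\<phi> ! i)"
      using word_filling_nth[OF shapes_distinct[OF \<Gamma>] len(1)] i len by (simp add: eq)
    from word_filling_SomeD[OF this] obtain k
      where "k < length \<phi>" "\<Gamma> ! i = \<Delta> ! k" "\<phi> ! i = \<phi> ! k" by auto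
    with assms i len show "\<Gamma> ! i = \<Delta> ! i" by (simp add: nth_eq_iff_index_eq)
  qed (simp add: len)
qed

lemma row_size_word_filling:
  assumes "distinct \<phi>"
  shows "row_size (word_filling \<phi> \<Gamma>) i = card (row_values (word_filling \<phi> \<Gamma>) i)"
proof -
  let ?g = "word_filling \<phi> \<Gamma>"
  have "row_values ?g i = (\<lambda>c. the (?g c)) ` {c \<in> dom ?g. fst c = i}"
    by (force simp: row_values_def)
  moreover have "inj_on (\<lambda>c. the (?g c)) {c \<in> dom ?g. fst c = i}"
  proof (rule inj_onI)
    fix c d assume "c \<in> {c \<in> dom ?g. fst c = i}" "d \<in> {c \<in> dom ?g. fst c = i}"
      and "the (?g c) = the (?g d)"
    then obtain u where "?g c = Some u" "?g d = Some u" by auto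
    then show "c = d"
      using assms by (auto dest!: word_filling_SomeD simp: nth_eq_iff_index_eq)
  qed
  ultimately show ?thesis by (simp add: row_size_def card_image)
qed

text \<open>The sign factors over the rows because \<open>length \<phi> - num_rows \<gamma>\<close>
  is the sum of the row sizes minus one. The assumption \<open>sep\<close> rules out the rows of
  weight 0, and a row with one extreme letter contributes its sign only.\<close>

lemma shape_weight_eq:
  fixes t :: "'b::comm_ring_1"
  assumes \<Gamma>: "\<Gamma> \<in> shapes \<tau> (1, 1) \<phi>" and "distinct \<phi>"
    and sep: "\<And>i. \<not> (a \<in> row_values (word_filling \<phi> \<Gamma>) i \<and> b \<in> row_values (word_filling \<phi> \<Gamma>) i)"
  defines "\<gamma> \<equiv> word_filling \<phi> \<Gamma>"
  shows "shape_weight t a b \<phi> \<Gamma> = (-1) ^ (length \<phi> - num_rows \<gamma>) *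
    (\<Prod>i | 1 \<le> i \<and> i \<le> num_rows \<gamma> \<and> a \<notin> row_values \<gamma> i \<and> b \<notin> row_values \<gamma> i.
       of_nat (row_size \<gamma> i) * t + 1)"
proof -
  note len = shapes_length[OF \<Gamma>]
  obtain k where k: "fst ` set \<Gamma> = {1..k}"
    using shapes_rows[OF \<Gamma>] by auto
  have dom: "dom \<gamma> = set \<Gamma>" by (simp add: \<gamma>_def dom_word_filling len)
  have rows: "num_rows \<gamma> = k" by (simp add: num_rows_def dom k)
  \<comment> \<open>Nonempty rows keep \<open>row_size \<gamma> i - 1\<close> exact in the count of
    cells below.\<close>
  have pos: "row_size \<gamma> i \<ge> 1" if "i \<in> {1..k}" for i
  proof -
    from that obtain c where "c \<in> set \<Gamma>" "fst c = i" using k by (metis imageE)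
    then have "c \<in> {c \<in> dom \<gamma>. fst c = i}" by (simp add: dom)
    moreover have "finite {c \<in> dom \<gamma>. fst c = i}" by (simp add: dom)
    ultimately have "row_size \<gamma> i > 0" unfolding row_size_def card_gt_0_iff by blast
    then show ?thesis by linarith
  qed
  have "length \<phi> = card (set \<Gamma>)"
    using shapes_distinct[OF \<Gamma>] by (simp add: distinct_card len)
  also have "\<dots> = (\<Sum>i\<in>{1..k}. row_size \<gamma> i)"
    using sum.image_gen[of "set \<Gamma>" "\<lambda>_. 1::nat" fst] by (simp add: k row_size_def dom)
  also have "\<dots> = (\<Sum>i\<in>{1..k}. (row_size \<gamma> i - 1) + 1)"
    by (rule sum.cong) (use pos in force)+
  also have "\<dots> = (\<Sum>i\<in>{1..k}. row_size \<gamma> i - 1) + k"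
    by (subst sum.distrib) simp
  finally have sign: "length \<phi> - k = (\<Sum>i\<in>{1..k}. row_size \<gamma> i - 1)"
    by simp
  have "shape_weight t a b \<phi> \<Gamma> = (\<Prod>i\<in>{1..k}. (-1) ^ (row_size \<gamma> i - 1) *
      (if a \<notin> row_values \<gamma> i \<and> b \<notin> row_values \<gamma> i then of_nat (row_size \<gamma> i) * t + 1 else 1))"
    unfolding shape_weight_def k
    by (rule prod.cong)
       (use sep row_size_word_filling[OF assms(2)] in \<open>auto simp: row_weight_def \<gamma>_def\<close>)
  also have "\<dots> = (-1) ^ (length \<phi> - k) *
      (\<Prod>i\<in>{i \<in> {1..k}. a \<notin> row_values \<gamma> i \<and> b \<notin> row_values \<gamma> i}. of_nat (row_size \<gamma> i) * t + 1)"
    by (subst prod.inter_filter) (simp_all add: prod.distrib sign power_sum)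
  also have "{i \<in> {1..k}. a \<notin> row_values \<gamma> i \<and> b \<notin> row_values \<gamma> i} =
      {i. 1 \<le> i \<and> i \<le> k \<and> a \<notin> row_values \<gamma> i \<and> b \<notin> row_values \<gamma> i}" by auto
  finally show ?thesis by (simp add: rows)
qed

lemma shape_weight_eq_0:
  assumes "\<Gamma> \<in> shapes \<tau> c \<phi>"
    and "a \<in> row_values (word_filling \<phi> \<Gamma>) i" "b \<in> row_values (word_filling \<phi> \<Gamma>) i"
  shows "shape_weight t a b \<phi> \<Gamma> = 0"
proof -
  from assms(2) have "i \<in> fst ` set \<Gamma>" by (rule row_values_row)
  then show ?thesis
    unfolding shape_weight_def by (rule prod_zero[rotated, OF bexI[rotated]])
      (use assms in \<open>simp_all add: row_weight_def\<close>)
qed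

theorem theorem6p4:
  fixes K :: "'a set" and \<phi> \<tau> :: "'a list"
  assumes "finite K" and "card K \<ge> 2"
    and "\<phi> \<in> permutations_of_set K" and "\<tau> \<in> permutations_of_set K"
  shows "let n = card K; t = [:0, 1:] :: int poly in
    (t - 1) ^ mt \<tau> \<phi> * t ^ rst \<tau> \<phi> * (t + 1) ^ io \<tau> \<phi> =
    (\<Sum>\<gamma> \<in> Phi \<tau> \<phi>. (-1) ^ (n - num_rows \<gamma>) *
       (\<Prod>i | 1 \<le> i \<and> i \<le> num_rows \<gamma> \<and>
              smallest \<tau> \<notin> row_values \<gamma> i \<and> largest \<tau> \<notin> row_values \<gamma> i.
          of_nat (row_size \<gamma> i) * t + 1))"
proof -
  define t where "t = ([:0, 1:] :: int poly)"
  define a b where "a = smallest \<tau>" and "b = largest \<tau>"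
  have s: "set \<phi> = K" "distinct \<phi>" "set \<tau> = K" "distinct \<tau>"
    using assms by (auto simp: permutations_of_set_def)
  have len: "length \<tau> \<ge> 2" "length \<phi> = card K"
    using s assms(2) distinct_card by metis+
  have ne: "\<phi> \<noteq> []" "\<tau> \<noteq> []" using len assms(2) by auto
  have ab: "a \<noteq> b"
    using smallest_neq_largest[OF s(4) len(1)] by (simp add: a_def b_def)
  have "a \<in> set \<phi>" "b \<in> set \<phi>"
    using ne by (auto simp: a_def b_def smallest_def largest_def s(1) simp flip: s(3))
  \<comment> \<open>This 2 is the one subtracted in \<open>rst\<close>; it matches the general
    exponent of \<open>t\<close> in the product over the runs.\<close>
  then have card: "card ({a, b} \<inter> set \<phi>) = 2"
    using ab by (simp add: Int_insert_left)
  define G where "G = {\<Gamma> \<in> shapes \<tau> (1, 1) \<phi>. \<forall>i.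
    \<not> (a \<in> row_values (word_filling \<phi> \<Gamma>) i \<and> b \<in> row_values (word_filling \<phi> \<Gamma>) i)}"
  have Phi: "Phi \<tau> \<phi> = word_filling \<phi> ` G"
    unfolding G_def shapes_eq_fits[OF s(4,2) s(1)[folded s(3)] ne(1)] Phi_def a_def b_def by blast
  have "(t - 1) ^ mt \<tau> \<phi> * t ^ rst \<tau> \<phi> * (t + 1) ^ io \<tau> \<phi> =
      prod_list (map (run_weight t a b) (rising_runs \<tau> \<phi>))"
    using prod_list_run_weight[OF Nil_notin_rising_runs _ ab, of \<tau> \<phi> t] s(2) card
    unfolding rst_def mt_def io_def concat_rising_runs a_def b_def by simp
  also have "\<dots> = weight_sum t a b \<tau> (1, 1) \<phi>"
    using weight_sum_eq[OF s(4) len(1) ne(1) s(2), of t "(1, 1)"] s by (simp add: a_def b_def)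
  \<comment> \<open>Shapes outside \<open>G\<close> have a row with both extreme letters and thus
    weight 0.\<close>
  also have "\<dots> = (\<Sum>\<Gamma>\<in>G. shape_weight t a b \<phi> \<Gamma>)"
    unfolding weight_sum_def
    by (rule sum.mono_neutral_right)
       (auto simp: finite_shapes G_def intro: shape_weight_eq_0)
  also have "\<dots> = (\<Sum>\<Gamma>\<in>G. (\<lambda>\<gamma>. (-1) ^ (card K - num_rows \<gamma>) *
       (\<Prod>i | 1 \<le> i \<and> i \<le> num_rows \<gamma> \<and> a \<notin> row_values \<gamma> i \<and> b \<notin> row_values \<gamma> i.
          of_nat (row_size \<gamma> i) * t + 1)) (word_filling \<phi> \<Gamma>))"
    by (rule sum.cong) (auto simp: G_def shape_weight_eq s(2) len(2))
  also have "\<dots> = (\<Sum>\<gamma>\<in>Phi \<tau> \<phi>. (-1) ^ (card K - num_rows \<gamma>) *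
       (\<Prod>i | 1 \<le> i \<and> i \<le> num_rows \<gamma> \<and> a \<notin> row_values \<gamma> i \<and> b \<notin> row_values \<gamma> i.
          of_nat (row_size \<gamma> i) * t + 1))"
    unfolding Phi
    by (subst sum.reindex)
       (auto simp: G_def intro: inj_on_subset[OF inj_on_word_filling[OF s(2)]])
  finally show ?thesis by (simp add: Let_def t_def a_def b_def)
qed

end
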